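(* Let $\mathbf{W}\in\mathbb{R}^{b\times c}$ be a matrix with no zero row and no zero column, and let $\mathbf{X}\in\mathbb{R}^{a\times b}$, $\mathbf{Y}\in\mathbb{R}^{c\times d}$ with $a=b$ and $c=d$. Suppose that $\mathbf{X},\mathbf{Y}$ are given by one of the following two strategies: (1) for every $j\in\{1,\dots,b\}$, $\mathbf{X}_{:j}=t_j\,(1;\dots;1)\in\mathbb{R}^{b\times 1}$ with $t_j=(\sqrt{b}\,\|\mathbf{W}_{j:}\|_1)^{-1}$, and for every $k\in\{1,\dots,c\}$, $\mathbf{Y}_{k:}=s_k\,(1,\dots,1)\in\mathbb{R}^{1\times c}$ with $s_k=(\sqrt{c}\,\|\mathbf{W}_{:k}\|_1)^{-1}$; (2) $\mathbf{X}=\mathrm{Diag}(\|\mathbf{W}_{1:}\|_1^{-1},\dots,\|\mathbf{W}_{b:}\|_1^{-1})$ and $\mathbf{Y}=\mathrm{Diag}(\|\mathbf{W}_{:1}\|_1^{-1},\dots,\|\mathbf{W}_{:c}\|_1^{-1})$. Then, in either case, for all $j\in\{1,\dots,b\}$ and $k\in\{1,\dots,c\}$, $$\|\mathbf{X}_{:j}\|_2+\|\mathbf{Y}_{k:}\|_2=\|\mathbf{W}_{j:}\|_1^{-1}+\|\mathbf{W}_{:k}\|_1^{-1}.$$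
   Context: $\mathbf{M}_{j:}$ and $\mathbf{M}_{:k}$ denote the $j$-th row and $k$-th column of a matrix $\mathbf{M}$. $\|\cdot\|_1,\|\cdot\|_2$ are the $\ell_1$- and $\ell_2$-norms of a vector. $\mathrm{Diag}(\cdot)$ is the diagonal matrix with the given diagonal entries; $(1;\dots;1)$ is the all-ones column vector and $(1,\dots,1)$ the all-ones row vector. *)

theory Defs
  imports "HOL-Analysis.Analysis"
begin

text \<open>The library norm on \<open>real ^ 'n\<close> is the Euclidean one (\<open>norm_vec_def\<close>, \<open>L2_set\<close>),
  so only the \<open>l\<^sub>1\<close>-norm has to be introduced.\<close>

definition l1_norm :: "real ^ 'n \<Rightarrow> real" where
  "l1_norm x = (\<Sum>i\<in>UNIV. \<bar>x $ i\<bar>)"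

definition diag_matrix :: "real ^ 'n \<Rightarrow> real ^ 'n ^ 'n" where
  "diag_matrix v = (\<chi> i j. if i = j then v $ i else 0)"

end

theory Submission
  imports Defs
begin

text \<open>Each summand is matched separately. Under the first strategy, the all-ones vector of
  length n has Euclidean norm sqrt n, cancelling the factor sqrt n in the scalar
  (\<open>norm_inverse_sqrt_scaleR_vec_one\<close>). Under the second, rows and columns of a
  diagonal matrix are multiples of coordinate vectors, whose norm is the modulus of the one entry
  (\<open>norm_axis\<close>).\<close>

lemma l1_norm_nonneg: "0 \<le> l1_norm x"
  by (simp add: l1_norm_def sum_nonneg)

lemma norm_one_vec: "norm (1 :: real ^ 'n) = sqrt (real CARD('n))"
  by (simp add: norm_vec_def L2_set_def)

text \<open>The sign condition removes the absolute value left by pulling the scalar out of the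
  norm; at \<open>r = 0\<close> both sides are 0, as \<open>inverse 0 = 0\<close>.\<close>

lemma norm_inverse_sqrt_scaleR_vec_one:
  assumes "0 \<le> r"
  shows "norm (inverse (sqrt (real CARD('n)) * r) *\<^sub>R (vec 1 :: real ^ 'n)) = inverse r"
  using assms by (simp add: norm_one_vec field_simps)

lemma column_diag_matrix: "column i (diag_matrix v) = axis i (v $ i)"
  by (auto simp: column_def diag_matrix_def axis_def vec_eq_iff)

lemma row_diag_matrix: "row i (diag_matrix v) = axis i (v $ i)"
  by (auto simp: row_def diag_matrix_def axis_def vec_eq_iff)

lemma norm_axis: "norm (axis i r :: real ^ 'n) = \<bar>r\<bar>"
  \<comment> \<open>Moving \<open>norm\<close> and the square inside the conditional lets the sum
    collapse to its single nonzero term.\<close>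
  by (simp add: norm_vec_def L2_set_def axis_def if_distrib[of norm] if_distrib[of "\<lambda>x. x\<^sup>2"] cong: if_cong)

theorem theorem3p5:
  fixes W :: "real ^ 'c ^ 'b"
    and X :: "real ^ 'b ^ 'b"
    and Y :: "real ^ 'c ^ 'c"
  assumes no_zero_row: "\<And>j. row j W \<noteq> 0"
    and no_zero_column: "\<And>k. column k W \<noteq> 0"
    and strategy:
      "((\<forall>j. column j X = inverse (sqrt (real CARD('b)) * l1_norm (row j W)) *\<^sub>R vec 1) \<and>
        (\<forall>k. row k Y = inverse (sqrt (real CARD('c)) * l1_norm (column k W)) *\<^sub>R vec 1))
       \<or>
       (X = diag_matrix (\<chi> j. inverse (l1_norm (row j W))) \<and>
        Y = diag_matrix (\<chi> k. inverse (l1_norm (column k W))))"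
  shows "\<forall>j k. norm (column j X) + norm (row k Y)
           = inverse (l1_norm (row j W)) + inverse (l1_norm (column k W))"
  using strategy
proof
  assume "(\<forall>j. column j X = inverse (sqrt (real CARD('b)) * l1_norm (row j W)) *\<^sub>R vec 1) \<and>
    (\<forall>k. row k Y = inverse (sqrt (real CARD('c)) * l1_norm (column k W)) *\<^sub>R vec 1)"
  then show ?thesis
    \<comment> \<open>The default rules would split the inverse of the product, and the norm lemma
      would no longer match.\<close>
    by (simp only: norm_inverse_sqrt_scaleR_vec_one[OF l1_norm_nonneg] simp_thms)
next
  assume "X = diag_matrix (\<chi> j. inverse (l1_norm (row j W))) \<and>
    Y = diag_matrix (\<chi> k. inverse (l1_norm (column k W)))"
  then show ?thesis
    \<comment> \<open>The diagonal entries are inverses of nonnegative numbers, so the moduli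
      drop.\<close>
    by (simp add: column_diag_matrix row_diag_matrix norm_axis l1_norm_nonneg)
qed

end
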